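(* For $0<\theta_F\le\theta_p\le\pi/2$ put $\rho_V=\rho_V(\theta_F,\theta_p)=\dfrac{\sin^2\theta_p-\sin^2\theta_F}{\sin^2\theta_p+\sin^2\theta_F}$ and $c_F=\cos\theta_F$. For fixed $\theta_F\in(0,\pi/2)$, $$\sup_{\theta_p\in[\theta_F,\pi/2]}\rho_V=\frac{1-\sin^2\theta_F}{1+\sin^2\theta_F}=\frac{c_F^2}{2-c_F^2},$$ attained at $\theta_p=\pi/2$ (which, when $\theta_F,\theta_p$ are the Friedrichs angle and the largest principal angle of a pair of subspaces $U,V\subseteq\mathbb{R}^n$ with $V\not\subset U$, requires $V\cap U^\perp\ne\{0\}$). The worst-case rate satisfies $$\frac{c_F^2}{2-c_F^2}<c_F^2\quad\text{whenever }\theta_F\in(0,\pi/2),$$ with explicit gap $$c_F^2-\frac{c_F^2}{2-c_F^2}=\frac{c_F^2(1-c_F^2)}{2-c_F^2}.$$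
   Context: For linear subspaces $U,V\subseteq\mathbb{R}^n$ with $V\not\subset U$, $p=\dim V$, $s=\dim(U\cap V)<p$, let $\sigma_1\ge\dots\ge\sigma_p\ge0$ be the singular values of $P_U|_V:V\to\mathbb{R}^n$ ($P_U$ the orthogonal projection onto $U$). The principal angles are $\theta_k=\arccos\sigma_k$, $0\le\theta_1\le\dots\le\theta_p\le\pi/2$; the first $s$ are $0$, and the Friedrichs angle is $\theta_F:=\theta_{s+1}\in(0,\pi/2]$; $\theta_p$ is the largest principal angle. *)

theory Defs
  imports "HOL-Analysis.Analysis"
begin

definition orth_proj :: "'a::euclidean_space set \<Rightarrow> 'a \<Rightarrow> 'a" where
  "orth_proj U x = (THE y. y \<in> U \<and> x - y \<in> U\<^sup>\<bottom>)"

text \<open>The library constant \<open>adjoint\<close> is for maps defined on a whole type. The following is the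
  adjoint \<open>T\<^sup>* : E \<Rightarrow> V\<close> of the restriction of \<open>T\<close> to a subspace \<open>V\<close>, with \<open>V\<close> carrying the
  induced inner product.\<close>

definition adjoint_on ::
    "'a::euclidean_space set \<Rightarrow> ('a \<Rightarrow> 'b::euclidean_space) \<Rightarrow> 'b \<Rightarrow> 'a" where
  "adjoint_on V T y = (THE x. x \<in> V \<and> (\<forall>v\<in>V. v \<bullet> x = T v \<bullet> y))"

text \<open>The eigenspace of \<open>T\<^sup>* T : V \<Rightarrow> V\<close> for the eigenvalue \<open>\<sigma>\<^sup>2\<close>.\<close>

definition singular_space ::
    "'a::euclidean_space set \<Rightarrow> ('a \<Rightarrow> 'b::euclidean_space) \<Rightarrow> real \<Rightarrow> 'a set" where
  "singular_space V T \<sigma> = {v \<in> V. adjoint_on V T (T v) = \<sigma>\<^sup>2 *\<^sub>R v}"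

text \<open>The singular values of \<open>T\<close> restricted to \<open>V\<close>: the nonnegative square roots of the
  eigenvalues of \<open>T\<^sup>* T\<close>, in decreasing order, each repeated according to its multiplicity.
  There are \<open>dim V\<close> of them, because \<open>T\<^sup>* T\<close> is self-adjoint.\<close>

definition singular_values ::
    "'a::euclidean_space set \<Rightarrow> ('a \<Rightarrow> 'b::euclidean_space) \<Rightarrow> real list" where
  "singular_values V T =
     concat (map (\<lambda>\<sigma>. replicate (dim (singular_space V T \<sigma>)) \<sigma>)
       (rev (sorted_list_of_set {\<sigma>. 0 \<le> \<sigma> \<and> singular_space V T \<sigma> \<noteq> {0}})))"

text \<open>Angles are numbered from \<open>1\<close> to \<open>dim V\<close>, whereas lists are indexed from \<open>0\<close>.\<close>

definition principal_angle ::
    "'a::euclidean_space set \<Rightarrow> 'a set \<Rightarrow> nat \<Rightarrow> real" where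
  "principal_angle U V k = arccos (singular_values V (orth_proj U) ! (k - 1))"

text \<open>Both angles below are meaningful only for subspaces with \<open>\<not> V \<subseteq> U\<close>.\<close>

definition friedrichs_angle :: "'a::euclidean_space set \<Rightarrow> 'a set \<Rightarrow> real" where
  "friedrichs_angle U V = principal_angle U V (dim (U \<inter> V) + 1)"

definition largest_principal_angle :: "'a::euclidean_space set \<Rightarrow> 'a set \<Rightarrow> real" where
  "largest_principal_angle U V = principal_angle U V (dim V)"

definition rho_V :: "real \<Rightarrow> real \<Rightarrow> real" where
  "rho_V \<theta>F \<theta>p = ((sin \<theta>p)\<^sup>2 - (sin \<theta>F)\<^sup>2) / ((sin \<theta>p)\<^sup>2 + (sin \<theta>F)\<^sup>2)"

end

theory Submission
  imports Defs
begin

text \<open>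
  The analytic part rests on
  \<open>rho_V \<theta>F \<theta>p = 1 - 2 (sin \<theta>F)\<^sup>2 / ((sin \<theta>p)\<^sup>2 + (sin \<theta>F)\<^sup>2)\<close>: the rate increases with
  \<open>(sin \<theta>p)\<^sup>2\<close>, which is largest, namely \<open>1\<close>, at the right end \<open>pi / 2\<close>. So the supremum is a
  maximum (\<open>rho_V_le_right_angle\<close>), and the comparison with \<open>cF\<^sup>2\<close> is algebra based on
  \<open>0 < cF\<^sup>2 < 1\<close>.

  The geometric part says that a right angle among the principal angles produces a common vector
  of \<open>V\<close> and \<open>U\<^sup>\<bottom>\<close>. A principal angle \<open>arccos \<sigma>\<close> comes with a vector \<open>v \<noteq> 0\<close> of \<open>V\<close> such
  that \<open>P\<^sub>U w \<bullet> P\<^sub>U v = \<sigma>\<^sup>2 (w \<bullet> v)\<close> for all \<open>w\<close> in \<open>V\<close>. Since \<open>P\<^sub>U\<close> does not increase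
  norms, \<open>0 \<le> \<sigma> \<le> 1\<close>, so that \<open>arccos \<sigma> = pi / 2\<close> forces \<open>\<sigma> = 0\<close>. Taking \<open>w = v\<close>
  gives \<open>P\<^sub>U v = 0\<close>, that is, \<open>v \<in> U\<^sup>\<bottom>\<close>.

  What has to be shown is that the last principal angle really belongs to such a vector, which
  means that the list of singular values has an entry with index \<open>dim V - 1\<close>. This is the
  spectral theorem for \<open>T\<^sup>* T\<close> on \<open>V\<close> (\<open>singular_spaces_span\<close>): the eigenspaces span
  \<open>V\<close>, hence their dimensions add up to at least \<open>dim V\<close> (\<open>dim_le_length_singular_values\<close>).
\<close>

section \<open>Orthogonal projections\<close>

lemma orth_proj_unique:
  assumes U: "subspace U" and y: "y \<in> U" "x - y \<in> U\<^sup>\<bottom>"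
  shows "orth_proj U x = y"
  unfolding orth_proj_def
proof (rule the_equality)
  fix z assume z: "z \<in> U \<and> x - z \<in> U\<^sup>\<bottom>"
  have "(x - y) - (x - z) \<in> U\<^sup>\<bottom>"
    using y z subspace_orthogonal_comp subspace_diff by blast
  then have "z - y \<in> U\<^sup>\<bottom>" by simp
  moreover have "z - y \<in> U" using U y z subspace_diff by blast
  ultimately have "orthogonal (z - y) (z - y)"
    by (simp add: orthogonal_comp_def)
  then show "z = y" by (simp add: orthogonal_def)
qed (use y in simp)

lemma orth_proj_works:
  assumes U: "subspace U"
  shows "orth_proj U x \<in> U" and "x - orth_proj U x \<in> U\<^sup>\<bottom>"
proof -
  obtain y z where yz: "y \<in> span U" "\<And>w. w \<in> span U \<Longrightarrow> orthogonal z w" "x = y + z"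
    using orthogonal_subspace_decomp_exists[of U x] by metis
  have y: "y \<in> U" using yz(1) U by (metis span_eq_iff)
  have "x - y \<in> U\<^sup>\<bottom>"
    using yz(2,3) by (auto simp: orthogonal_comp_def orthogonal_commute span_base)
  with y show "orth_proj U x \<in> U" "x - orth_proj U x \<in> U\<^sup>\<bottom>"
    using orth_proj_unique[OF U] by auto
qed

lemma linear_orth_proj:
  assumes U: "subspace U"
  shows "linear (orth_proj U)"
proof (rule linearI)
  note W = orth_proj_works[OF U] and perp = subspace_orthogonal_comp[of U]
  fix x y :: 'a and c :: real
  have "(x - orth_proj U x) + (y - orth_proj U y) \<in> U\<^sup>\<bottom>"
    using W perp subspace_add by blast
  then have "(x + y) - (orth_proj U x + orth_proj U y) \<in> U\<^sup>\<bottom>"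
    by (simp add: algebra_simps)
  with W U show "orth_proj U (x + y) = orth_proj U x + orth_proj U y"
    by (intro orth_proj_unique) (auto intro: subspace_add)
  have "c *\<^sub>R (x - orth_proj U x) \<in> U\<^sup>\<bottom>"
    using W perp subspace_scale by blast
  then have "c *\<^sub>R x - c *\<^sub>R orth_proj U x \<in> U\<^sup>\<bottom>"
    by (simp add: algebra_simps)
  with W U show "orth_proj U (c *\<^sub>R x) = c *\<^sub>R orth_proj U x"
    by (intro orth_proj_unique) (auto intro: subspace_scale)
qed

lemma norm_orth_proj_le:
  assumes U: "subspace U"
  shows "norm (orth_proj U x) \<le> norm x"
proof -
  let ?p = "orth_proj U x"
  have "?p \<bullet> (x - ?p) = 0"
    using orth_proj_works[OF U, of x] by (auto simp: orthogonal_comp_def orthogonal_def)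
  then have "(norm ?p)\<^sup>2 = ?p \<bullet> x"
    by (simp add: power2_norm_eq_inner inner_diff_right)
  also have "\<dots> \<le> norm ?p * norm x" by (rule norm_cauchy_schwarz)
  finally have "norm ?p * norm ?p \<le> norm ?p * norm x" by (simp add: power2_eq_square)
  then show ?thesis
    by (cases "norm ?p = 0") auto
qed

section \<open>Spectral theorem for singular spaces\<close>

text \<open>Testing \<open>T\<^sup>* T v = \<sigma>\<^sup>2 v\<close> against all vectors of \<open>V\<close> turns it into a condition on
  inner products. The adjoint of the restriction exists because it is the projection to \<open>V\<close> of
  the adjoint of \<open>T\<close> on the whole space.\<close>

lemma singular_space_iff:
  assumes V: "subspace V" and T: "linear T"
  shows "v \<in> singular_space V T \<sigma> \<longleftrightarrow>
    v \<in> V \<and> (\<forall>w\<in>V. T w \<bullet> T v = \<sigma>\<^sup>2 * (w \<bullet> v))"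
proof -
  have uniq: "x = z" if "x \<in> V" "z \<in> V" "\<forall>w\<in>V. w \<bullet> x = w \<bullet> z" for x z
  proof -
    have "x - z \<in> V" using that V subspace_diff by blast
    with that(3) have "(x - z) \<bullet> (x - z) = 0"
      by (metis eq_iff_diff_eq_0 inner_diff_right)
    then show ?thesis by simp
  qed
  define a where "a = orth_proj V (adjoint T (T v))"
  have a: "a \<in> V" "w \<bullet> a = T w \<bullet> T v" if "w \<in> V" for w
  proof -
    show "a \<in> V" unfolding a_def by (rule orth_proj_works[OF V])
    have "w \<bullet> (adjoint T (T v) - a) = 0"
      using orth_proj_works(2)[OF V, of "adjoint T (T v)"] that
      unfolding a_def by (simp add: orthogonal_comp_def orthogonal_def)
    then show "w \<bullet> a = T w \<bullet> T v"
      using adjoint_works[OF T] by (simp add: inner_diff_right)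
  qed
  have "0 \<in> V" using V by (rule subspace_0)
  note aV = a(1)[OF this]
  have "adjoint_on V T (T v) = a"
    unfolding adjoint_on_def
  proof (rule the_equality)
    show "a \<in> V \<and> (\<forall>w\<in>V. w \<bullet> a = T w \<bullet> T v)" using a aV by blast
    show "x = a" if "x \<in> V \<and> (\<forall>w\<in>V. w \<bullet> x = T w \<bullet> T v)" for x
      using that aV a by (intro uniq) auto
  qed
  moreover have "a = \<sigma>\<^sup>2 *\<^sub>R v \<longleftrightarrow> (\<forall>w\<in>V. T w \<bullet> T v = \<sigma>\<^sup>2 * (w \<bullet> v))" if "v \<in> V"
  proof
    assume "a = \<sigma>\<^sup>2 *\<^sub>R v"
    then show "\<forall>w\<in>V. T w \<bullet> T v = \<sigma>\<^sup>2 * (w \<bullet> v)"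
      using a by fastforce
  next
    assume *: "\<forall>w\<in>V. T w \<bullet> T v = \<sigma>\<^sup>2 * (w \<bullet> v)"
    have "\<sigma>\<^sup>2 *\<^sub>R v \<in> V" using that V subspace_scale by blast
    with * show "a = \<sigma>\<^sup>2 *\<^sub>R v"
      using aV a by (intro uniq) auto
  qed
  ultimately show ?thesis
    unfolding singular_space_def by auto
qed

lemma zero_in_singular_space:
  assumes "subspace V" and "linear T"
  shows "0 \<in> singular_space V T \<sigma>"
  using assms by (simp add: singular_space_iff linear_0 subspace_0)

text \<open>Evaluating \<open>T v \<bullet> T w\<close> from either side gives \<open>\<sigma>\<^sup>2 (v \<bullet> w) = \<tau>\<^sup>2 (v \<bullet> w)\<close>; the signs
  matter because \<open>\<sigma>\<close> and \<open>- \<sigma>\<close> have the same singular space.\<close>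

lemma singular_spaces_orthogonal:
  assumes V: "subspace V" and T: "linear T"
    and v: "v \<in> singular_space V T \<sigma>" and w: "w \<in> singular_space V T \<tau>"
    and "0 \<le> \<sigma>" "0 \<le> \<tau>" "\<sigma> \<noteq> \<tau>"
  shows "orthogonal v w"
proof -
  have "T w \<bullet> T v = \<sigma>\<^sup>2 * (w \<bullet> v)" "T v \<bullet> T w = \<tau>\<^sup>2 * (v \<bullet> w)"
    using v w by (auto simp: singular_space_iff[OF V T])
  then have "(\<sigma>\<^sup>2 - \<tau>\<^sup>2) * (v \<bullet> w) = 0"
    by (auto simp: inner_commute algebra_simps)
  moreover have "\<sigma>\<^sup>2 \<noteq> \<tau>\<^sup>2" using assms(5-7) by simp
  ultimately show ?thesis by (simp add: orthogonal_def)
qed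

text \<open>Nonzero vectors chosen from the different singular spaces are pairwise orthogonal, and the
  dimension bounds the number of such vectors.\<close>

lemma finite_singular_value_set:
  assumes V: "subspace V" and T: "linear T"
  shows "finite {\<sigma>. 0 \<le> \<sigma> \<and> singular_space V T \<sigma> \<noteq> {0}}" (is "finite ?S")
proof -
  have "\<exists>v. v \<in> singular_space V T \<sigma> \<and> v \<noteq> 0" if "\<sigma> \<in> ?S" for \<sigma>
    using that zero_in_singular_space[OF V T, of \<sigma>] by blast
  then obtain e where e: "\<And>\<sigma>. \<sigma> \<in> ?S \<Longrightarrow> e \<sigma> \<in> singular_space V T \<sigma> \<and> e \<sigma> \<noteq> 0"
    by metis
  have orth: "orthogonal (e \<sigma>) (e \<tau>)" if "\<sigma> \<in> ?S" "\<tau> \<in> ?S" "\<sigma> \<noteq> \<tau>" for \<sigma> \<tau>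
    using that e singular_spaces_orthogonal[OF V T] by blast
  have "pairwise orthogonal (e ` ?S)"
    using orth unfolding pairwise_def by blast
  then have "finite (e ` ?S)" by (rule pairwise_orthogonal_imp_finite)
  moreover have "inj_on e ?S"
  proof (rule inj_onI, rule ccontr)
    fix \<sigma> \<tau> assume *: "\<sigma> \<in> ?S" "\<tau> \<in> ?S" "e \<sigma> = e \<tau>" "\<sigma> \<noteq> \<tau>"
    with orth[of \<sigma> \<tau>] have "e \<sigma> = 0" by (simp add: orthogonal_self)
    with e[OF *(1)] show False by simp
  qed
  ultimately show ?thesis by (rule finite_imageD)
qed

text \<open>The variational argument: at a maximum point \<open>x\<close> of \<open>\<parallel>T x\<parallel>\<^sup>2\<close> on the unit sphere of \<open>W\<close>,
  with value \<open>m\<close>, the quadratic form \<open>m \<parallel>y\<parallel>\<^sup>2 - \<parallel>T y\<parallel>\<^sup>2\<close> is nonnegative on \<open>W\<close> and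
  vanishes at \<open>x\<close>. Hence \<open>x\<close> lies in the kernel of the associated bilinear form.\<close>

lemma exists_singular_vector:
  fixes W :: "'a::euclidean_space set" and T :: "'a \<Rightarrow> 'b::euclidean_space"
  assumes W: "subspace W" "W \<noteq> {0}" and T: "linear T"
  obtains x \<sigma> where "x \<in> W" "x \<noteq> 0" "0 \<le> \<sigma>" "\<And>y. y \<in> W \<Longrightarrow> T y \<bullet> T x = \<sigma>\<^sup>2 * (y \<bullet> x)"
proof -
  let ?S = "sphere 0 1 \<inter> W"
  obtain u where u: "u \<in> W" "u \<noteq> 0" using W subspace_0 by blast
  then have "u /\<^sub>R norm u \<in> ?S" using W(1) by (simp add: subspace_scale)
  moreover have "compact ?S"
    using closed_subspace[OF W(1)] by (simp add: compact_Int_closed)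
  moreover have "continuous_on ?S (\<lambda>x. T x \<bullet> T x)"
    using T by (intro continuous_intros linear_continuous_on) (simp_all add: linear_linear)
  ultimately obtain x where x: "x \<in> ?S" and max: "\<And>y. y \<in> ?S \<Longrightarrow> T y \<bullet> T y \<le> T x \<bullet> T x"
    using continuous_attains_sup[of ?S "\<lambda>x. T x \<bullet> T x"] by blast
  define m where "m = T x \<bullet> T x"
  have xx: "x \<bullet> x = 1" and xW: "x \<in> W"
    using x by (auto simp: norm_eq_1)
  have form_nonneg: "T y \<bullet> T y \<le> m * (y \<bullet> y)" if "y \<in> W" for y
  proof (cases "y = 0")
    case True
    then show ?thesis by (simp add: linear_0[OF T])
  next
    case False
    have "y /\<^sub>R norm y \<in> ?S" using that False W(1) by (simp add: subspace_scale)
    from max[OF this] have "(T y \<bullet> T y) / (norm y)\<^sup>2 \<le> m"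
      by (simp add: linear_cmul[OF T] m_def power2_eq_square field_simps)
    then show ?thesis
      using False by (simp add: divide_le_eq power2_norm_eq_inner)
  qed
  have "T y \<bullet> T x = (sqrt m)\<^sup>2 * (y \<bullet> x)" if y: "y \<in> W" for y
  proof -
    define b where "b = m * (y \<bullet> x) - T y \<bullet> T x"
    define q where "q = m * (y \<bullet> y) - T y \<bullet> T y"
    have q0: "0 \<le> q" using form_nonneg[OF y] by (simp add: q_def)
    have quad: "0 \<le> 2 * t * b + t\<^sup>2 * q" for t
    proof -
      have "x + t *\<^sub>R y \<in> W" using xW y W(1) by (simp add: subspace_add subspace_scale)
      from form_nonneg[OF this] show ?thesis
        by (simp add: linear_add[OF T] linear_cmul[OF T] inner_add_left inner_add_right xx
            m_def[symmetric] b_def q_def inner_commute power2_eq_square algebra_simps)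
    qed
    \<comment> \<open>The minimiser \<open>- b / q\<close> of the quadratic, with \<open>q\<close> enlarged so as to be positive.\<close>
    define t where "t = - b / (q + 1)"
    have tq: "t * (q + 1) = - b" using q0 by (simp add: t_def)
    have "2 * t * b + t\<^sup>2 * q = - (t\<^sup>2 * (q + 2))"
      using tq by algebra
    with quad[of t] have "t\<^sup>2 * (q + 2) \<le> 0" by simp
    then have "t = 0" using q0 by (simp add: mult_le_0_iff)
    with tq have "b = 0" by simp
    moreover have "0 \<le> m" by (simp add: m_def)
    ultimately show ?thesis by (simp add: b_def)
  qed
  moreover have "x \<noteq> 0" using xx by auto
  moreover have "0 \<le> sqrt m" by (simp add: m_def)
  ultimately show thesis using that xW by blast
qed

text \<open>Otherwise the orthogonal complement \<open>W\<close> in \<open>V\<close> of the span would contain a singular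
  vector for \<open>W\<close>. It is one for all of \<open>V\<close>, because \<open>T\<^sup>* T\<close> maps the span to itself. So it
  lies both in the span and in its orthogonal complement.\<close>

lemma singular_spaces_span:
  fixes V :: "'a::euclidean_space set" and T :: "'a \<Rightarrow> 'b::euclidean_space"
  assumes V: "subspace V" and T: "linear T"
  shows "V \<subseteq> span (\<Union>\<sigma>\<in>{\<sigma>. 0 \<le> \<sigma> \<and> singular_space V T \<sigma> \<noteq> {0}}. singular_space V T \<sigma>)"
    (is "V \<subseteq> span ?E")
proof -
  note iff = singular_space_iff[OF V T]
  have EV: "?E \<subseteq> V" by (auto simp: iff)
  then have spanV: "span ?E \<subseteq> V" using V span_minimal by blast
  define W where "W = V \<inter> (span ?E)\<^sup>\<bottom>"
  have W: "subspace W"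
    unfolding W_def by (intro subspace_Int V subspace_orthogonal_comp subspace_inter)
  have decomp: "v - orth_proj (span ?E) v \<in> W" if "v \<in> V" for v
    using orth_proj_works[of "span ?E" v] that spanV V
    unfolding W_def by (auto intro: subspace_diff)
  have "W = {0}"
  proof (rule ccontr)
    assume "W \<noteq> {0}"
    then obtain x \<sigma> where x: "x \<in> W" "x \<noteq> 0" "0 \<le> \<sigma>"
      and eq: "\<And>y. y \<in> W \<Longrightarrow> T y \<bullet> T x = \<sigma>\<^sup>2 * (y \<bullet> x)"
      using exists_singular_vector[OF W _ T] by metis
    have perp: "s \<bullet> x = 0" if "s \<in> span ?E" for s
      using x(1) that by (simp add: W_def orthogonal_comp_def orthogonal_def)
    have Tperp: "T s \<bullet> T x = 0" if "s \<in> span ?E" for s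
      using that
    proof (induction rule: span_induct_alt)
      case base
      then show ?case by (simp add: linear_0[OF T])
    next
      case (step c e y)
      then obtain \<tau> where "e \<in> singular_space V T \<tau>" by blast
      then have "T x \<bullet> T e = \<tau>\<^sup>2 * (x \<bullet> e)" using x(1) by (simp add: iff W_def)
      moreover have "e \<bullet> x = 0" by (rule perp[OF span_base[OF step(1)]])
      ultimately show ?case
        using step by (simp add: linear_add[OF T] linear_cmul[OF T] inner_add_left
            inner_commute[of "T e"] inner_commute[of e])
    qed
    have "T v \<bullet> T x = \<sigma>\<^sup>2 * (v \<bullet> x)" if "v \<in> V" for v
    proof -
      let ?s = "orth_proj (span ?E) v"
      have "?s \<in> span ?E" by (rule orth_proj_works) simp
      with perp Tperp eq[OF decomp[OF that]] show ?thesis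
        by (simp add: linear_diff[OF T] inner_diff_left)
    qed
    then have "x \<in> singular_space V T \<sigma>" using x(1) by (simp add: iff W_def)
    with x(2,3) have "x \<in> ?E" by auto
    then have "x \<bullet> x = 0" by (intro perp span_base)
    with x(2) show False by simp
  qed
  show ?thesis
  proof
    fix v assume "v \<in> V"
    then have "v = orth_proj (span ?E) v" using decomp \<open>W = {0}\<close> by fastforce
    then show "v \<in> span ?E" using orth_proj_works(1)[of "span ?E" v] by simp
  qed
qed

section \<open>Singular values\<close>

lemma dim_UN_le_sum_dim:
  fixes S :: "'i \<Rightarrow> 'a::euclidean_space set"
  assumes I: "finite I"
  shows "dim (\<Union>i\<in>I. S i) \<le> (\<Sum>i\<in>I. dim (S i))"
proof -
  have "\<exists>B. finite B \<and> S i \<subseteq> span B \<and> card B = dim (S i)" for i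
    using basis_exists[of "S i"] finiteI_independent by metis
  then obtain B where B: "\<And>i. finite (B i) \<and> S i \<subseteq> span (B i) \<and> card (B i) = dim (S i)"
    by metis
  have "S i \<subseteq> span (\<Union>i\<in>I. B i)" if "i \<in> I" for i
    using B[of i] span_mono[of "B i" "\<Union>i\<in>I. B i"] that by blast
  then have "dim (\<Union>i\<in>I. S i) \<le> card (\<Union>i\<in>I. B i)"
    using B I by (intro dim_le_card) auto
  also have "\<dots> \<le> (\<Sum>i\<in>I. card (B i))" using I by (rule card_UN_le)
  finally show ?thesis using B by simp
qed

lemma dim_le_length_singular_values:
  fixes V :: "'a::euclidean_space set" and T :: "'a \<Rightarrow> 'b::euclidean_space"
  assumes V: "subspace V" and T: "linear T"
  shows "dim V \<le> length (singular_values V T)"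
proof -
  let ?S = "{\<sigma>. 0 \<le> \<sigma> \<and> singular_space V T \<sigma> \<noteq> {0}}"
  have fin: "finite ?S" by (rule finite_singular_value_set[OF V T])
  have "dim V \<le> dim (\<Union>\<sigma>\<in>?S. singular_space V T \<sigma>)"
    using singular_spaces_span[OF V T] dim_mono by blast
  also have "\<dots> \<le> (\<Sum>\<sigma>\<in>?S. dim (singular_space V T \<sigma>))"
    using fin by (rule dim_UN_le_sum_dim)
  also have "\<dots> = (\<Sum>\<sigma>\<leftarrow>rev (sorted_list_of_set ?S). dim (singular_space V T \<sigma>))"
    using fin by (subst sum_list_distinct_conv_sum_set) auto
  also have "\<dots> = length (singular_values V T)"
    by (simp add: singular_values_def length_concat comp_def)
  finally show ?thesis .
qed

lemma singular_value_obtains_vector: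
  fixes V :: "'a::euclidean_space set" and T :: "'a \<Rightarrow> 'b::euclidean_space"
  assumes V: "subspace V" and T: "linear T" and \<sigma>: "\<sigma> \<in> set (singular_values V T)"
  obtains v where "v \<in> V" "v \<noteq> 0" "0 \<le> \<sigma>" "norm (T v) = \<sigma> * norm v"
proof -
  have "\<sigma> \<in> {\<sigma>. 0 \<le> \<sigma> \<and> singular_space V T \<sigma> \<noteq> {0}}"
    using \<sigma> finite_singular_value_set[OF V T]
    by (auto simp: singular_values_def split: if_splits)
  then obtain v where v: "v \<in> singular_space V T \<sigma>" "v \<noteq> 0" and "0 \<le> \<sigma>"
    using zero_in_singular_space[OF V T, of \<sigma>] by blast
  from v(1) have "v \<in> V" "T v \<bullet> T v = \<sigma>\<^sup>2 * (v \<bullet> v)"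
    by (simp_all add: singular_space_iff[OF V T])
  then have "(norm (T v))\<^sup>2 = (\<sigma> * norm v)\<^sup>2"
    by (simp add: power2_norm_eq_inner power_mult_distrib)
  then have "norm (T v) = \<sigma> * norm v"
    using \<open>0 \<le> \<sigma>\<close> by simp
  with that v \<open>v \<in> V\<close> \<open>0 \<le> \<sigma>\<close> show thesis by blast
qed

section \<open>Principal angles\<close>

text \<open>The bound \<open>k \<le> dim V\<close> matters: past the end of the list of singular values, the angle
  carries no information about \<open>U\<close> and \<open>V\<close>.\<close>

lemma principal_angle_obtains_vector:
  fixes U V :: "'a::euclidean_space set"
  assumes U: "subspace U" and V: "subspace V" and k: "1 \<le> k" "k \<le> dim V"
  obtains v where "v \<in> V" "v \<noteq> 0" "norm (orth_proj U v) = cos (principal_angle U V k) * norm v"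
proof -
  note T = linear_orth_proj[OF U]
  define \<sigma> where "\<sigma> = singular_values V (orth_proj U) ! (k - 1)"
  have "k - 1 < length (singular_values V (orth_proj U))"
    using k dim_le_length_singular_values[OF V T] by linarith
  then have "\<sigma> \<in> set (singular_values V (orth_proj U))" by (simp add: \<sigma>_def)
  then obtain v where v: "v \<in> V" "v \<noteq> 0" "0 \<le> \<sigma>" "norm (orth_proj U v) = \<sigma> * norm v"
    using singular_value_obtains_vector[OF V T] by blast
  have "\<sigma> * norm v \<le> 1 * norm v" using norm_orth_proj_le[OF U, of v] v(4) by simp
  then have "\<sigma> \<le> 1" using v(2) by simp
  with v(3) have "cos (principal_angle U V k) = \<sigma>"
    by (simp add: principal_angle_def \<sigma>_def)
  with v that show thesis by simp
qed

lemma right_principal_angle_imp_common_vector: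
  fixes U V :: "'a::euclidean_space set"
  assumes U: "subspace U" and V: "subspace V" and k: "1 \<le> k" "k \<le> dim V"
    and right: "principal_angle U V k = pi / 2"
  shows "V \<inter> U\<^sup>\<bottom> \<noteq> {0}"
proof -
  obtain v where v: "v \<in> V" "v \<noteq> 0" "norm (orth_proj U v) = cos (pi / 2) * norm v"
    by (rule principal_angle_obtains_vector[OF U V k, unfolded right])
  then have "orth_proj U v = 0" by simp
  then have "v \<in> U\<^sup>\<bottom>" using orth_proj_works(2)[OF U, of v] by simp
  with v show ?thesis by blast
qed

section \<open>The rate\<close>

lemma rho_V_le_right_angle:
  assumes "sin \<theta>F \<noteq> 0"
  shows "rho_V \<theta>F \<theta>p \<le> rho_V \<theta>F (pi / 2)"
proof -
  let ?a = "(sin \<theta>F)\<^sup>2" and ?b = "(sin \<theta>p)\<^sup>2"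
  have a: "0 < ?a" using assms by simp
  have rho: "rho_V \<theta>F \<theta> = 1 - 2 * ?a / ((sin \<theta>)\<^sup>2 + ?a)" for \<theta>
    using a sum_squares_gt_zero_iff[of "sin \<theta>" "sin \<theta>F"] assms
    by (simp add: rho_V_def field_simps power2_eq_square)
  have "?b \<le> 1" by (simp add: abs_square_le_1)
  then have "2 * ?a / (1 + ?a) \<le> 2 * ?a / (?b + ?a)"
    using a by (intro divide_left_mono mult_pos_pos) (auto intro: add_nonneg_pos)
  then show ?thesis by (simp add: rho)
qed

theorem proposition4p8:
  fixes \<theta>F cF :: real
  assumes "0 < \<theta>F" and "\<theta>F < pi / 2"
    and "cF = cos \<theta>F"
  shows "bdd_above (rho_V \<theta>F ` {\<theta>F..pi / 2})
    \<and> (SUP \<theta>p\<in>{\<theta>F..pi / 2}. rho_V \<theta>F \<theta>p) = (1 - (sin \<theta>F)\<^sup>2) / (1 + (sin \<theta>F)\<^sup>2)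
    \<and> (1 - (sin \<theta>F)\<^sup>2) / (1 + (sin \<theta>F)\<^sup>2) = cF\<^sup>2 / (2 - cF\<^sup>2)
    \<and> rho_V \<theta>F (pi / 2) = (SUP \<theta>p\<in>{\<theta>F..pi / 2}. rho_V \<theta>F \<theta>p)
    \<and> (\<forall>U V :: (real ^ 'n) set.
         subspace U \<and> subspace V \<and> \<not> V \<subseteq> U
           \<and> friedrichs_angle U V = \<theta>F \<and> largest_principal_angle U V = pi / 2
         \<longrightarrow> V \<inter> U\<^sup>\<bottom> \<noteq> {0})
    \<and> cF\<^sup>2 / (2 - cF\<^sup>2) < cF\<^sup>2
    \<and> cF\<^sup>2 - cF\<^sup>2 / (2 - cF\<^sup>2) = cF\<^sup>2 * (1 - cF\<^sup>2) / (2 - cF\<^sup>2)"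
proof (intro conjI allI impI)
  have sF: "0 < sin \<theta>F" using assms(1,2) by (intro sin_gt_zero) auto
  have cF: "0 < cF" unfolding assms(3) using assms(1,2) by (intro cos_gt_zero) auto
  have sq: "(sin \<theta>F)\<^sup>2 = 1 - cF\<^sup>2"
    using assms(3) by (simp add: sin_squared_eq)
  have c0: "0 < cF\<^sup>2" using cF by simp
  have c1: "cF\<^sup>2 < 1" using sq sF zero_less_power[OF sF, of 2] by linarith
  have le: "rho_V \<theta>F \<theta>p \<le> rho_V \<theta>F (pi / 2)" for \<theta>p
    using sF by (intro rho_V_le_right_angle) simp
  then show "bdd_above (rho_V \<theta>F ` {\<theta>F..pi / 2})" by (rule bdd_aboveI2)
  have sup: "(SUP \<theta>p\<in>{\<theta>F..pi / 2}. rho_V \<theta>F \<theta>p) = rho_V \<theta>F (pi / 2)"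
    using le assms(2) by (intro cSup_eq_maximum) auto
  then show "(SUP \<theta>p\<in>{\<theta>F..pi / 2}. rho_V \<theta>F \<theta>p) = (1 - (sin \<theta>F)\<^sup>2) / (1 + (sin \<theta>F)\<^sup>2)"
    by (simp add: rho_V_def)
  show "rho_V \<theta>F (pi / 2) = (SUP \<theta>p\<in>{\<theta>F..pi / 2}. rho_V \<theta>F \<theta>p)"
    using sup by simp
  show "(1 - (sin \<theta>F)\<^sup>2) / (1 + (sin \<theta>F)\<^sup>2) = cF\<^sup>2 / (2 - cF\<^sup>2)"
    by (simp add: sq)
  show gap: "cF\<^sup>2 - cF\<^sup>2 / (2 - cF\<^sup>2) = cF\<^sup>2 * (1 - cF\<^sup>2) / (2 - cF\<^sup>2)"
    using c1 by (simp add: field_simps)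
  have "0 < cF\<^sup>2 * (1 - cF\<^sup>2) / (2 - cF\<^sup>2)"
    using c0 c1 by simp
  with gap show "cF\<^sup>2 / (2 - cF\<^sup>2) < cF\<^sup>2" by linarith
  fix U V :: "(real ^ 'n) set"
  assume UV: "subspace U \<and> subspace V \<and> \<not> V \<subseteq> U
    \<and> friedrichs_angle U V = \<theta>F \<and> largest_principal_angle U V = pi / 2"
  then have "\<not> V \<subseteq> {0}" using subspace_0 by blast
  then have "1 \<le> dim V" by (metis dim_eq_0 less_one linorder_not_le)
  with UV show "V \<inter> U\<^sup>\<bottom> \<noteq> {0}"
    by (intro right_principal_angle_imp_common_vector[of U V "dim V"])
      (auto simp: largest_principal_angle_def)
qed

end
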